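(* For every integer $d \ge 5$ there exists a binary form $p_d$ of degree $d$ which takes at least three different ranks; that is, there exist a binary form $p_d(x,y)$ of degree $d$ and subfields $K_1, K_2, K_3 \subseteq \mathbb{C}$, each containing all the coefficients of $p_d$, such that the three numbers $L_{K_1}(p_d)$, $L_{K_2}(p_d)$, $L_{K_3}(p_d)$ are pairwise distinct.
   Context: A binary form of degree $d$ is a nonzero homogeneous polynomial $f(x,y)$ of degree $d$ in two variables with coefficients in a field $K \subseteq \mathbb{C}$. For a field $K \subseteq \mathbb{C}$ containing the coefficients of $f$, the $K$-rank (or $K$-length) $L_K(f)$ is the smallest integer $r$ for which there is a representation $$f(x,y) = \sum_{j=1}^r \lambda_j(\alpha_j x + \beta_j y)^d$$ with $\lambda_j, \alpha_j, \beta_j \in K$ for all $j$. The ranks taken by $f$ are the values $L_K(f)$ as $K$ ranges over the subfields of $\mathbb{C}$ containing the coefficients of $f$. *)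

theory Defs
  imports
    Complex_Main
    "HOL-Computational_Algebra.Polynomial"
    "HOL-Algebra.Algebraic_Closure_Type"
begin

text \<open>
  Bivariate polynomials over \<open>\<complex>\<close> are elements of \<open>\<complex>[x][y]\<close>: the outer variable is \<open>y\<close>, the
  inner one is \<open>x\<close>, so the coefficient of \<open>x\<^sup>i y\<^sup>j\<close> in \<open>f\<close> is \<open>bcoeff f i j\<close>.
\<close>

definition bcoeff :: "complex poly poly \<Rightarrow> nat \<Rightarrow> nat \<Rightarrow> complex" where
  "bcoeff f i j = Polynomial.coeff (Polynomial.coeff f j) i"

definition binary_form :: "nat \<Rightarrow> complex poly poly \<Rightarrow> bool" where
  "binary_form d f \<longleftrightarrow> f \<noteq> 0 \<and> (\<forall>i j. bcoeff f i j \<noteq> 0 \<longrightarrow> i + j = d)"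

definition coeffs_in :: "complex set \<Rightarrow> complex poly poly \<Rightarrow> bool" where
  "coeffs_in K f \<longleftrightarrow> (\<forall>i j. bcoeff f i j \<in> K)"

definition linear_form :: "complex \<Rightarrow> complex \<Rightarrow> complex poly poly" where
  "linear_form \<alpha> \<beta> = [:[:0, \<alpha>:], [:\<beta>:]:]"

definition complex_subfield :: "complex set \<Rightarrow> bool" where
  "complex_subfield K \<longleftrightarrow> subfield K (ring_of_type_algebra :: complex ring)"

definition has_K_representation ::
    "complex set \<Rightarrow> nat \<Rightarrow> complex poly poly \<Rightarrow> nat \<Rightarrow> bool" where
  "has_K_representation K d f r \<longleftrightarrow>
     (\<exists>\<mu> \<alpha> \<beta> :: nat \<Rightarrow> complex.
        (\<forall>j\<in>{1..r}. \<mu> j \<in> K \<and> \<alpha> j \<in> K \<and> \<beta> j \<in> K) \<and>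
        f = (\<Sum>j=1..r. Polynomial.smult [:\<mu> j:] (linear_form (\<alpha> j) (\<beta> j) ^ d)))"

text \<open>
  The length \<open>L\<^sub>K(f)\<close> of a form \<open>f\<close> of degree \<open>d\<close> with coefficients in the subfield \<open>K\<close>. For such
  \<open>f\<close> a representation always exists, because \<open>K\<close> is infinite and of characteristic \<open>0\<close> (so the
  \<open>d\<close>-th powers of linear forms over \<open>K\<close> span all forms of degree \<open>d\<close> over \<open>K\<close>); hence the
  minimum is attained.
\<close>

definition K_rank :: "complex set \<Rightarrow> nat \<Rightarrow> complex poly poly \<Rightarrow> nat" where
  "K_rank K d f = (LEAST r. has_K_representation K d f r)"

lemma complex_subfield_iff:
  "complex_subfield K \<longleftrightarrow>
     1 \<in> K \<and> (\<forall>a\<in>K. \<forall>b\<in>K. a - b \<in> K \<and> a * b \<in> K) \<and> (\<forall>a\<in>K. inverse a \<in> K)"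
proof -
  define R where "R = (ring_of_type_algebra :: complex ring)"
  have R_simps: "carrier R = UNIV" "\<one>\<^bsub>R\<^esub> = 1" "\<zero>\<^bsub>R\<^esub> = 0"
    "a \<otimes>\<^bsub>R\<^esub> b = a * b" "a \<oplus>\<^bsub>R\<^esub> b = a + b" for a b
    by (simp_all add: R_def ring_of_type_algebra_def)
  interpret R: Ring.field R
    unfolding R_def by (rule field_from_type_algebra)
  have neg: "\<ominus>\<^bsub>R\<^esub> a = - a" for a
    by (rule R.minus_equality) (simp_all add: R_simps)
  have inv: "inv\<^bsub>R\<^esub> a = inverse a" if "a \<noteq> 0" for a
    by (rule R.comm_inv_char) (use that in \<open>simp_all add: R_simps\<close>)
  show ?thesis
    unfolding complex_subfield_def R_def[symmetric]
  proof
    assume K: "subfield K R"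
    have sub: "subring K R"
      by (rule subfieldE(1)[OF K])
    have one: "1 \<in> K" and zero: "0 \<in> K"
      using subringE(2,3)[OF sub] by (simp_all add: R_simps)
    have minus: "- a \<in> K" if "a \<in> K" for a
      using subringE(5)[OF sub that] by (simp add: neg)
    have add: "a + b \<in> K" and mult: "a * b \<in> K" if "a \<in> K" "b \<in> K" for a b
      using subringE(6,7)[OF sub that] by (simp_all add: R_simps)
    have "inverse a \<in> K" if "a \<in> K" for a
    proof (cases "a = 0")
      case False
      then have "inv\<^bsub>R\<^esub> a \<in> K"
        using R.subfield_m_inv(1)[OF K, of a] that by (simp add: R_simps)
      then show ?thesis
        using False by (simp add: inv)
    qed (use zero in simp)
    moreover have "a - b \<in> K" if "a \<in> K" "b \<in> K" for a b
      using add[OF that(1) minus[OF that(2)]] by simp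
    ultimately show "1 \<in> K \<and> (\<forall>a\<in>K. \<forall>b\<in>K. a - b \<in> K \<and> a * b \<in> K) \<and> (\<forall>a\<in>K. inverse a \<in> K)"
      using one mult by blast
  next
    assume *: "1 \<in> K \<and> (\<forall>a\<in>K. \<forall>b\<in>K. a - b \<in> K \<and> a * b \<in> K) \<and> (\<forall>a\<in>K. inverse a \<in> K)"
    have "0 \<in> K"
      using * by (metis diff_self)
    then have minus: "- a \<in> K" if "a \<in> K" for a
      using * that by (metis diff_0)
    have add: "a + b \<in> K" if "a \<in> K" "b \<in> K" for a b
      using * that(1) minus[OF that(2)] by (metis diff_minus_eq_add)
    have "subring K R"
      by (rule R.subringI) (use * minus add in \<open>auto simp: R_simps neg\<close>)
    then show "subfield K R"
      by (rule R.subfieldI') (use * in \<open>auto simp: R_simps inv\<close>)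
  qed
qed

end

theory Submission
  imports Defs
begin

text \<open>
  Take \<open>p = A (x + \<i> y)^d + cnj A (x - \<i> y)^d - 2 x^d\<close>, which has rank at most 3 over \<open>\<complex>\<close>.
  If \<open>p\<close> is a combination of the powers \<open>(\<alpha>\<^sub>j x + \<beta>\<^sub>j y)^d\<close>, \<open>j \<le> r\<close>, then pairing with
  multiples of \<open>q(z) = \<Prod>(\<alpha>\<^sub>j z - \<beta>\<^sub>j)\<close> (Sylvester's apolarity) gives \<open>q(\<i>) = 0\<close> when
  \<open>r \<le> d - 2\<close>, which is impossible over a field without \<open>\<i>\<close>, and \<open>A q(\<i>) = q(0)\<close> when
  \<open>r \<le> d - 1\<close>. For real coefficients \<open>\<bar>q(\<i>)\<bar> \<ge> \<bar>q(0)\<bar>\<close>, so \<open>\<bar>A\<bar> > 1\<close> forces rank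
  at least \<open>d\<close> over \<open>\<real>\<close>. Conversely, a polynomial \<open>q\<close> with \<open>d - 1\<close> distinct roots in \<open>K\<close> and
  \<open>A q(\<i>) = q(0) = cnj A q(-\<i>)\<close> yields a representation of length \<open>d - 1\<close> over \<open>K\<close>. Over
  \<open>K = \<rat>(\<surd>-2)\<close> this is achieved by \<open>q(z) = \<Prod>(z\<^sup>2 + m\<^sup>2/2)\<close> over \<open>m \<ge> 2\<close>, with an additional
  factor \<open>z - 1\<close> if \<open>d\<close> is even.
\<close>

section \<open>Closure properties of subfields of the complex numbers\<close>

lemma subfield_closed:
  assumes "complex_subfield K"
  shows "1 \<in> K" "0 \<in> K"
    "a \<in> K \<Longrightarrow> b \<in> K \<Longrightarrow> a + b \<in> K"
    "a \<in> K \<Longrightarrow> b \<in> K \<Longrightarrow> a - b \<in> K"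
    "a \<in> K \<Longrightarrow> b \<in> K \<Longrightarrow> a * b \<in> K"
    "a \<in> K \<Longrightarrow> b \<in> K \<Longrightarrow> a / b \<in> K"
    "of_nat n \<in> K"
    "(\<And>x. x \<in> S \<Longrightarrow> g x \<in> K) \<Longrightarrow> sum g S \<in> K"
proof -
  note K = assms[unfolded complex_subfield_iff]
  show one: "1 \<in> K" using K by blast
  show zero: "0 \<in> K" using K by (metis diff_self)
  have add: "a + b \<in> K" if "a \<in> K" "b \<in> K" for a b
    using K zero that by (metis diff_0 diff_minus_eq_add)
  show "a \<in> K \<Longrightarrow> b \<in> K \<Longrightarrow> a + b \<in> K" by (rule add)
  show "a \<in> K \<Longrightarrow> b \<in> K \<Longrightarrow> a - b \<in> K" using K by blast
  show "a \<in> K \<Longrightarrow> b \<in> K \<Longrightarrow> a * b \<in> K" using K by blast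
  show "a \<in> K \<Longrightarrow> b \<in> K \<Longrightarrow> a / b \<in> K" using K by (simp add: divide_inverse)
  show "of_nat n \<in> K" by (induction n) (auto intro: zero one add)
  show "(\<And>x. x \<in> S \<Longrightarrow> g x \<in> K) \<Longrightarrow> sum g S \<in> K"
    by (induction S rule: infinite_finite_induct) (auto intro: zero add)
qed

section \<open>Forms by normalised coefficients\<close>

text \<open>With the binomials split off, the \<open>d\<close>-th power of \<alpha> x + \<beta> y
  has the coefficient sequence \<alpha>^(d-k) \<beta>^k, so a representation as a sum of powers
  becomes a system of moment equations.\<close>

definition form_of :: "nat \<Rightarrow> (nat \<Rightarrow> complex) \<Rightarrow> complex poly poly" where
  "form_of d a = (\<Sum>k\<le>d. Polynomial.monom (Polynomial.monom (of_nat (d choose k) * a k) (d - k)) k)"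

lemma bcoeff_form_of: "bcoeff (form_of d a) i j = (if i + j = d then of_nat (d choose j) * a j else 0)"
proof -
  have "Polynomial.coeff (form_of d a) j =
      (if j \<le> d then Polynomial.monom (of_nat (d choose j) * a j) (d - j) else 0)"
    by (simp add: form_of_def Polynomial.coeff_sum)
  then show ?thesis
    by (auto simp: bcoeff_def)
qed

lemma form_of_eq_iff: "form_of d a = form_of d b \<longleftrightarrow> (\<forall>k\<le>d. a k = b k)"
proof
  assume eq: "form_of d a = form_of d b"
  show "\<forall>k\<le>d. a k = b k"
  proof (intro allI impI)
    fix k assume "k \<le> d"
    with arg_cong[OF eq, of "\<lambda>f. bcoeff f (d - k) k"] show "a k = b k"
      by (simp add: bcoeff_form_of)
  qed
qed (simp add: form_of_def)

lemma sum_powers_eq_form_of: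
  "(\<Sum>j\<in>J. Polynomial.smult [:\<mu> j:] (linear_form (\<alpha> j) (\<beta> j) ^ d)) =
    form_of d (\<lambda>k. \<Sum>j\<in>J. \<mu> j * \<alpha> j ^ (d - k) * \<beta> j ^ k)"
proof (rule poly_eqI, rule poly_eqI)
  fix n i
  have "bcoeff (linear_form a b ^ d) i n =
      (if i + n = d then of_nat (d choose n) * a ^ i * b ^ n else 0)" for a b :: complex
  proof (cases "n \<le> d")
    case True
    have mon: "[:0, a:] = Polynomial.monom a 1" by (simp add: monom_altdef)
    have "bcoeff (linear_form a b ^ d) i n =
        Polynomial.coeff (of_nat (d choose n) * [:b ^ n:] * Polynomial.monom (a ^ (d - n)) (d - n)) i"
      using True
      by (simp add: bcoeff_def linear_form_def coeff_linear_poly_power mon monom_power poly_const_pow)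
    also have "\<dots> = of_nat (d choose n) * b ^ n * (if d - n = i then a ^ (d - n) else 0)"
      by (simp add: of_nat_poly)
    finally show ?thesis using True by auto
  next
    case False
    have "Polynomial.degree (linear_form a b) \<le> 1"
      by (simp add: linear_form_def)
    then have "Polynomial.degree (linear_form a b) * d \<le> 1 * d"
      by (rule mult_le_mono1)
    with degree_power_le[of "linear_form a b" d]
    have "Polynomial.degree (linear_form a b ^ d) \<le> d"
      by linarith
    with False show ?thesis by (auto simp: bcoeff_def Polynomial.coeff_eq_0)
  qed
  note B = this
  have "Polynomial.coeff (Polynomial.coeff (\<Sum>j\<in>J. Polynomial.smult [:\<mu> j:] (linear_form (\<alpha> j) (\<beta> j) ^ d)) n) i
      = (\<Sum>j\<in>J. \<mu> j * bcoeff (linear_form (\<alpha> j) (\<beta> j) ^ d) i n)"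
    by (simp add: Polynomial.coeff_sum bcoeff_def)
  also have "\<dots> = bcoeff (form_of d (\<lambda>k. \<Sum>j\<in>J. \<mu> j * \<alpha> j ^ (d - k) * \<beta> j ^ k)) i n"
    by (cases "i + n = d") (auto simp: B bcoeff_form_of sum_distrib_left mult_ac)
  finally show "Polynomial.coeff (Polynomial.coeff (\<Sum>j\<in>J. Polynomial.smult [:\<mu> j:] (linear_form (\<alpha> j) (\<beta> j) ^ d)) n) i
      = Polynomial.coeff (Polynomial.coeff (form_of d (\<lambda>k. \<Sum>j\<in>J. \<mu> j * \<alpha> j ^ (d - k) * \<beta> j ^ k)) n) i"
    by (simp add: bcoeff_def)
qed

section \<open>Representations with prescribed nodes\<close>

text \<open>A node \<open>s\<close> stands for the linear form x + s y. Solving the moment equations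
  with weights \<open>w\<close> is therefore the same as writing the form as a sum of powers of such
  forms.\<close>

lemma has_K_representation_form_of_nodes:
  assumes "complex_subfield K" "finite S" "\<And>s. s \<in> S \<Longrightarrow> s \<in> K \<and> w s \<in> K"
    and a: "\<And>k. k \<le> d \<Longrightarrow> (\<Sum>s\<in>S. w s * s ^ k) = a k"
  shows "has_K_representation K d (form_of d a) (card S)"
proof -
  obtain h where h: "bij_betw h {1..card S} S"
    using ex_bij_betw_nat_finite_1[OF assms(2)] by blast
  have "form_of d a = form_of d (\<lambda>k. \<Sum>j=1..card S. w (h j) * 1 ^ (d - k) * h j ^ k)"
    unfolding form_of_eq_iff
    by (auto simp: a[symmetric] sum.reindex_bij_betw[OF h, of "\<lambda>s. w s * s ^ _", symmetric])
  also have "\<dots> = (\<Sum>j=1..card S. Polynomial.smult [:w (h j):] (linear_form 1 (h j) ^ d))"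
    by (subst sum_powers_eq_form_of) simp
  finally show ?thesis
    unfolding has_K_representation_def
    using assms(3) bij_betwE[OF h] subfield_closed(1)[OF assms(1)]
    by (intro exI[of _ "\<lambda>j. w (h j)"] exI[of _ "\<lambda>j. 1"] exI[of _ h]) auto
qed

text \<open>The induction step replaces \<open>a k\<close> by \<open>a (k + 1) - x * a k\<close>, which eliminates the node \<open>x\<close>.\<close>

lemma vandermonde_solvable:
  assumes K: "complex_subfield K" and "finite S" "S \<subseteq> K" "\<And>k. a k \<in> K"
  shows "\<exists>w. (\<forall>s\<in>S. w s \<in> K) \<and> (\<forall>k<card S. (\<Sum>s\<in>S. w s * s ^ k) = a k)"
  using assms(2-4)
proof (induction S arbitrary: a rule: finite_induct)
  case (insert x F)
  have "\<exists>\<mu>. (\<forall>s\<in>F. \<mu> s \<in> K) \<and> (\<forall>k<card F. (\<Sum>s\<in>F. \<mu> s * s ^ k) = a (Suc k) - x * a k)"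
    using insert.prems by (intro insert.IH) (auto intro!: subfield_closed[OF K])
  then obtain \<mu> where \<mu>: "\<And>s. s \<in> F \<Longrightarrow> \<mu> s \<in> K"
    "\<And>k. k < card F \<Longrightarrow> (\<Sum>s\<in>F. \<mu> s * s ^ k) = a (Suc k) - x * a k" by blast
  \<comment> \<open>The elimination leaves a factor \<open>s - x\<close> on the weight of
    \<open>s\<close>, which the division removes. The weight of \<open>x\<close> is then fixed by
    the moment at 0.\<close>
  define \<nu> where "\<nu> s = \<mu> s / (s - x)" for s
  define w where "w = \<nu>(x := a 0 - sum \<nu> F)"
  have \<nu>K: "\<nu> s \<in> K" if "s \<in> F" for s
    using that insert.prems \<mu>(1) by (auto simp: \<nu>_def intro!: subfield_closed[OF K])
  have F: "(\<Sum>s\<in>F. w s * g s) = (\<Sum>s\<in>F. \<nu> s * g s)" for g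
    using insert.hyps by (intro sum.cong) (auto simp: w_def)
  have "(\<Sum>s\<in>insert x F. w s * s ^ k) = a k" if "k < card (insert x F)" for k
    using that
  proof (induction k)
    case 0
    then show ?case using insert.hyps F[of "\<lambda>_. 1"] by (simp add: w_def)
  next
    case (Suc k)
    have "(\<Sum>s\<in>insert x F. w s * s ^ Suc k) - x * (\<Sum>s\<in>insert x F. w s * s ^ k)
        = (\<Sum>s\<in>F. w s * ((s - x) * s ^ k))"
      using insert.hyps by (simp add: sum_distrib_left sum_subtractf algebra_simps)
    also have "\<dots> = (\<Sum>s\<in>F. \<mu> s * s ^ k)"
      unfolding F using insert.hyps by (intro sum.cong) (auto simp: \<nu>_def)
    also have "\<dots> = a (Suc k) - x * a k"
      using Suc.prems insert.hyps by (intro \<mu>(2)) auto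
    finally show ?case using Suc insert.hyps by simp
  qed
  moreover have "\<forall>s\<in>insert x F. w s \<in> K"
    using insert.prems \<nu>K by (auto simp: w_def intro!: subfield_closed[OF K])
  ultimately show ?case by blast
qed auto

section \<open>Homogeneous functions and the apolarity pairing\<close>

text \<open>Binary forms as functions: the pairing below needs only their values at points, together
  with the existence of some coefficients.\<close>

definition hom_fun :: "nat \<Rightarrow> (complex \<Rightarrow> complex \<Rightarrow> complex) \<Rightarrow> bool" where
  "hom_fun n u \<longleftrightarrow> (\<exists>c. \<forall>x y. u x y = (\<Sum>k\<le>n. c k * (x ^ (n - k) * y ^ k)))"

lemma hom_fun_one: "hom_fun 0 (\<lambda>x y. 1)"
  unfolding hom_fun_def by (intro exI[of _ "\<lambda>_. 1"]) simp

lemma hom_fun_linear_mult: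
  assumes "hom_fun n u"
  shows "hom_fun (Suc n) (\<lambda>x y. (p * x + q * y) * u x y)"
proof -
  obtain c where c: "\<And>x y. u x y = (\<Sum>k\<le>n. c k * (x ^ (n - k) * y ^ k))"
    using assms unfolding hom_fun_def by blast
  \<comment> \<open>Multiplication by x keeps the index of a coefficient, padding with 0 at
    \<open>Suc n\<close>; multiplication by y shifts it by one.\<close>
  define c' where "c' k = p * (if k \<le> n then c k else 0) + q * (case k of 0 \<Rightarrow> 0 | Suc m \<Rightarrow> c m)" for k
  have mult_x: "x * (\<Sum>k\<le>n. c k * (x ^ (n - k) * y ^ k)) =
      (\<Sum>k\<le>Suc n. (if k \<le> n then c k else 0) * (x ^ (Suc n - k) * y ^ k))" for x y
    by (simp add: sum_distrib_left Suc_diff_le mult_ac)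
  have mult_y: "y * (\<Sum>k\<le>n. c k * (x ^ (n - k) * y ^ k)) =
      (\<Sum>k\<le>Suc n. (case k of 0 \<Rightarrow> 0 | Suc m \<Rightarrow> c m) * (x ^ (Suc n - k) * y ^ k))" for x y
    by (subst sum.atMost_Suc_shift) (simp add: sum_distrib_left mult_ac)
  have "(p * x + q * y) * u x y = (\<Sum>k\<le>Suc n. c' k * (x ^ (Suc n - k) * y ^ k))" for x y
  proof -
    have "(p * x + q * y) * u x y = p * (x * u x y) + q * (y * u x y)"
      by (simp add: algebra_simps)
    also have "\<dots> = (\<Sum>k\<le>Suc n. c' k * (x ^ (Suc n - k) * y ^ k))"
      unfolding c mult_x mult_y
      by (simp only: c'_def distrib_right sum.distrib sum_distrib_left mult.assoc)
    finally show ?thesis .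
  qed
  then show ?thesis unfolding hom_fun_def by blast
qed

lemma hom_fun_power_mult:
  assumes "hom_fun n u"
  shows "hom_fun (n + e + f) (\<lambda>x y. x ^ e * y ^ f * u x y)"
proof -
  have e: "hom_fun (n + e) (\<lambda>x y. x ^ e * u x y)"
  proof (induction e)
    case (Suc e)
    then show ?case using hom_fun_linear_mult[OF Suc, of 1 0] by (simp add: mult_ac)
  qed (use assms in simp)
  show ?thesis
  proof (induction f)
    case (Suc f)
    then show ?case using hom_fun_linear_mult[OF Suc, of 0 1] by (simp add: mult_ac)
  qed (use e in simp)
qed

lemma hom_fun_prod:
  "finite J \<Longrightarrow> hom_fun (card J) (\<lambda>x y. \<Prod>j\<in>J. \<alpha> j * y - \<beta> j * x)"
proof (induction J rule: finite_induct)
  case (insert x F)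
  then show ?case
    using hom_fun_linear_mult[OF insert.IH, of "- \<beta> x" "\<alpha> x"] by simp
qed (simp add: hom_fun_one)

text \<open>Up to binomial factors, these are the coefficients of
  \<open>A (x + \<i> y)^d + cnj A (x - \<i> y)^d - 2 x^d\<close>.\<close>

definition moments :: "complex \<Rightarrow> nat \<Rightarrow> complex" where
  "moments A k = A * \<i> ^ k + cnj A * (- \<i>) ^ k - 2 * 0 ^ k"

text \<open>The dual form \<open>q(x, y) = \<Prod>(\<alpha> j y - \<beta> j x)\<close> of a representation annihilates it, as
  do its multiples by monomials; \<open>q\<close> appears below through its values at \<open>x = 1\<close>.\<close>

lemma apolar_of_representation:
  assumes d: "d \<ge> 1" and rep: "has_K_representation K d (form_of d (moments A)) r"
  obtains J :: "nat set" and \<alpha> \<beta> where "finite J" "card J \<le> r"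
    "\<And>j. j \<in> J \<Longrightarrow> \<alpha> j \<in> K \<and> \<beta> j \<in> K \<and> (\<alpha> j \<noteq> 0 \<or> \<beta> j \<noteq> 0)"
    "\<And>f. card J + f \<le> d \<Longrightarrow>
      A * \<i> ^ f * (\<Prod>j\<in>J. \<alpha> j * \<i> - \<beta> j) + cnj A * (- \<i>) ^ f * (\<Prod>j\<in>J. \<alpha> j * (- \<i>) - \<beta> j)
        = 2 * 0 ^ f * (\<Prod>j\<in>J. - \<beta> j)"
proof -
  obtain \<mu> \<alpha> \<beta> where K: "\<And>j. j \<in> {1..r} \<Longrightarrow> \<mu> j \<in> K \<and> \<alpha> j \<in> K \<and> \<beta> j \<in> K"
    and eq: "form_of d (moments A) = (\<Sum>j=1..r. Polynomial.smult [:\<mu> j:] (linear_form (\<alpha> j) (\<beta> j) ^ d))"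
    using rep unfolding has_K_representation_def by blast
  \<comment> \<open>Zero linear forms are discarded so that no factor of the dual form vanishes
    identically. They contribute nothing to any moment: as \<open>d \<ge> 1\<close>, one of the
    exponents \<open>d - k\<close> and \<open>k\<close> is positive.\<close>
  define J where "J = {j\<in>{1..r}. \<alpha> j \<noteq> 0 \<or> \<beta> j \<noteq> 0}"
  have J: "finite J" "card J \<le> r"
    using card_mono[of "{1..r}" J] by (simp_all add: J_def subset_eq)
  have mom: "moments A k = (\<Sum>j\<in>J. \<mu> j * \<alpha> j ^ (d - k) * \<beta> j ^ k)" if "k \<le> d" for k
  proof -
    have "moments A k = (\<Sum>j=1..r. \<mu> j * \<alpha> j ^ (d - k) * \<beta> j ^ k)"
      using eq that unfolding sum_powers_eq_form_of form_of_eq_iff by blast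
    also have "\<dots> = (\<Sum>j\<in>J. \<mu> j * \<alpha> j ^ (d - k) * \<beta> j ^ k)"
      using that d by (intro sum.mono_neutral_right) (auto simp: J_def power_0_left)
    finally show ?thesis .
  qed
  \<comment> \<open>The functional sending x^(d-k) y^k to \<open>moments A k\<close> is computed
    twice: by definition it evaluates at (1, i), (1, -i), (1, 0) with weights \<open>A\<close>,
    \<open>cnj A\<close>, -2; by the representation it evaluates at the points
    \<open>(\<alpha> j, \<beta> j)\<close>.\<close>
  have pair: "A * u 1 \<i> + cnj A * u 1 (- \<i>) - 2 * u 1 0 = (\<Sum>j\<in>J. \<mu> j * u (\<alpha> j) (\<beta> j))"
    if hom: "hom_fun d u" for u
  proof -
    obtain c where c: "\<And>x y. u x y = (\<Sum>k\<le>d. c k * (x ^ (d - k) * y ^ k))"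
      using hom unfolding hom_fun_def by blast
    have "A * u 1 \<i> + cnj A * u 1 (- \<i>) - 2 * u 1 0 = (\<Sum>k\<le>d. c k * moments A k)"
      unfolding c moments_def
      by (simp only: power_one mult_1_left sum_distrib_left sum.distrib sum_subtractf
          distrib_left right_diff_distrib mult_ac)
    also have "\<dots> = (\<Sum>k\<le>d. \<Sum>j\<in>J. \<mu> j * (c k * (\<alpha> j ^ (d - k) * \<beta> j ^ k)))"
      by (intro sum.cong) (auto simp: mom sum_distrib_left mult_ac)
    also have "\<dots> = (\<Sum>j\<in>J. \<mu> j * u (\<alpha> j) (\<beta> j))"
      unfolding c sum_distrib_left by (rule sum.swap)
    finally show ?thesis .
  qed
  show thesis
  proof (rule that[OF J])
    show "\<alpha> j \<in> K \<and> \<beta> j \<in> K \<and> (\<alpha> j \<noteq> 0 \<or> \<beta> j \<noteq> 0)" if "j \<in> J" for j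
      using that K by (auto simp: J_def)
    fix f assume f: "card J + f \<le> d"
    \<comment> \<open>The dual form vanishes at every \<open>(\<alpha> j, \<beta> j)\<close>; the
      monomial raises its degree to \<open>d\<close> and contributes the factor y^f at x =
      1.\<close>
    define u where "u x y = x ^ (d - card J - f) * y ^ f * (\<Prod>j\<in>J. \<alpha> j * y - \<beta> j * x)" for x y
    have "hom_fun d u"
      using hom_fun_power_mult[OF hom_fun_prod[OF J(1)], of "d - card J - f" f \<alpha> \<beta>] f
      by (simp add: u_def[abs_def])
    moreover have "u (\<alpha> j) (\<beta> j) = 0" if "j \<in> J" for j
      using that J by (auto simp: u_def mult.commute)
    ultimately have "A * u 1 \<i> + cnj A * u 1 (- \<i>) - 2 * u 1 0 = 0"
      using pair[of u] by simp
    then show "A * \<i> ^ f * (\<Prod>j\<in>J. \<alpha> j * \<i> - \<beta> j) + cnj A * (- \<i>) ^ f * (\<Prod>j\<in>J. \<alpha> j * (- \<i>) - \<beta> j)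
        = 2 * 0 ^ f * (\<Prod>j\<in>J. - \<beta> j)"
      by (simp add: u_def mult_ac)
  qed
qed

section \<open>Lower bounds for the length\<close>

text \<open>When \<open>card J\<close> may be as large as \<open>d - 1\<close>, only the multipliers
  1 and y are sure to be available. They do not force q(i) = 0, so the size of \<open>A\<close> has
  to give the contradiction.\<close>

lemma real_representation_length:
  assumes d: "d \<ge> 1" and A: "cmod A > 1"
    and rep: "has_K_representation \<real> d (form_of d (moments A)) r"
  shows "d \<le> r"
proof (rule ccontr)
  assume r: "\<not> d \<le> r"
  obtain J :: "nat set" and \<alpha> \<beta> where J: "finite J" "card J \<le> r"
    and K: "\<And>j. j \<in> J \<Longrightarrow> \<alpha> j \<in> \<real> \<and> \<beta> j \<in> \<real> \<and> (\<alpha> j \<noteq> 0 \<or> \<beta> j \<noteq> 0)"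
    and eq: "\<And>f. card J + f \<le> d \<Longrightarrow>
      A * \<i> ^ f * (\<Prod>j\<in>J. \<alpha> j * \<i> - \<beta> j) + cnj A * (- \<i>) ^ f * (\<Prod>j\<in>J. \<alpha> j * (- \<i>) - \<beta> j)
        = 2 * 0 ^ f * (\<Prod>j\<in>J. - \<beta> j)"
    using apolar_of_representation[OF d rep] by blast
  define q where "q z = (\<Prod>j\<in>J. \<alpha> j * z - \<beta> j)" for z
  \<comment> \<open>The multiplier y kills the term at 0 and makes \<open>A * q \<i>\<close> and
    \<open>cnj A * q (- \<i>)\<close> equal; the multiplier 1 gives their sum.\<close>
  have "A * q \<i> + cnj A * q (- \<i>) = 2 * q 0" "\<i> * (A * q \<i> - cnj A * q (- \<i>)) = 0"
    using eq[of 0] eq[of 1] r J(2) by (simp_all add: q_def algebra_simps)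
  then have Aq: "A * q \<i> = q 0" by auto
  have norm_i: "cmod (x * \<i> - y) = sqrt (Re x ^ 2 + Re y ^ 2)" if "x \<in> \<real>" "y \<in> \<real>" for x y
    using that by (simp add: cmod_def complex_is_Real_iff)
  have "cmod (\<alpha> j * 0 - \<beta> j) \<le> cmod (\<alpha> j * \<i> - \<beta> j)" if "j \<in> J" for j
  proof -
    have "\<alpha> j \<in> \<real>" "\<beta> j \<in> \<real>" using K[OF that] by auto
    then show ?thesis
      using real_sqrt_ge_abs2[of "Re (\<beta> j)" "Re (\<alpha> j)"]
      by (simp add: norm_i cmod_eq_Re complex_is_Real_iff)
  qed
  then have "cmod (q 0) \<le> cmod (q \<i>)"
    unfolding q_def prod_norm[symmetric] by (intro prod_mono) auto
  \<comment> \<open>This makes the final comparison strict. A factor with real coefficients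
    vanishing at i would have both coefficients 0, which \<open>J\<close> excludes.\<close>
  moreover have "q \<i> \<noteq> 0"
  proof
    assume "q \<i> = 0"
    then obtain j where "j \<in> J" "\<alpha> j * \<i> - \<beta> j = 0" using J by (auto simp: q_def)
    then show False using K[of j] norm_i[of "\<alpha> j" "\<beta> j"]
      by (auto simp: complex_is_Real_iff complex_eq_iff)
  qed
  moreover have "cmod (q 0) = cmod A * cmod (q \<i>)"
    by (simp add: Aq[symmetric] norm_mult)
  ultimately show False
    using A mult_strict_right_mono[of 1 "cmod A" "cmod (q \<i>)"] by simp
qed

text \<open>With one more spare degree, the multipliers y and y^2 both kill the term at 0 and
  together force q(i) = 0. A vanishing factor then exhibits i as a quotient of elements of
  \<open>K\<close>.\<close>

lemma representation_length_without_i: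
  assumes K: "complex_subfield K" "\<i> \<notin> K" and A: "A \<noteq> 0" and d: "d \<ge> 1"
    and rep: "has_K_representation K d (form_of d (moments A)) r"
  shows "d \<le> r + 1"
proof (rule ccontr)
  assume r: "\<not> d \<le> r + 1"
  obtain J :: "nat set" and \<alpha> \<beta> where J: "finite J" "card J \<le> r"
    and JK: "\<And>j. j \<in> J \<Longrightarrow> \<alpha> j \<in> K \<and> \<beta> j \<in> K \<and> (\<alpha> j \<noteq> 0 \<or> \<beta> j \<noteq> 0)"
    and eq: "\<And>f. card J + f \<le> d \<Longrightarrow>
      A * \<i> ^ f * (\<Prod>j\<in>J. \<alpha> j * \<i> - \<beta> j) + cnj A * (- \<i>) ^ f * (\<Prod>j\<in>J. \<alpha> j * (- \<i>) - \<beta> j)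
        = 2 * 0 ^ f * (\<Prod>j\<in>J. - \<beta> j)"
    using apolar_of_representation[OF d rep] by blast
  define q where "q z = (\<Prod>j\<in>J. \<alpha> j * z - \<beta> j)" for z
  have "\<i> * (A * q \<i> - cnj A * q (- \<i>)) = 0" "A * q \<i> + cnj A * q (- \<i>) = 0"
    using eq[of 1] eq[of 2] r J(2)
    by (simp_all add: q_def algebra_simps power2_eq_square add_eq_0_iff)
  then have "q \<i> = 0" using A by auto
  then obtain j where j: "j \<in> J" "\<alpha> j * \<i> = \<beta> j" using J by (auto simp: q_def)
  then have "\<alpha> j \<noteq> 0" using JK by fastforce
  then have "\<i> = \<beta> j / \<alpha> j" using j by (simp add: field_simps)
  then show False using K j JK[of j] subfield_closed(6)[OF K(1)] by metis
qed

section \<open>Length \<open>d - 1\<close> from apolar nodes\<close>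

text \<open>The error sequence \<open>\<Sum>w s * s ^ k - moments A k\<close> satisfies the linear recurrence with
  characteristic polynomial \<open>\<Prod>(z - s)\<close> at \<open>k = d - 1\<close> and \<open>k = d\<close>, so it stays zero there.\<close>

lemma has_K_representation_apolar_nodes:
  assumes K: "complex_subfield K" and S: "finite S" "S \<subseteq> K" "card S = d - 1" and d: "d \<ge> 1"
    and mom: "\<And>k. moments A k \<in> K"
    and A: "A * (\<Prod>s\<in>S. \<i> - s) = (\<Prod>s\<in>S. - s)" "cnj A * (\<Prod>s\<in>S. - \<i> - s) = (\<Prod>s\<in>S. - s)"
  shows "has_K_representation K d (form_of d (moments A)) (d - 1)"
proof -
  obtain w where w: "\<And>s. s \<in> S \<Longrightarrow> w s \<in> K"
    "\<And>k. k < d - 1 \<Longrightarrow> (\<Sum>s\<in>S. w s * s ^ k) = moments A k"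
    using vandermonde_solvable[OF K S(1,2), of "moments A"] mom S(3) by auto
  define err where "err k = (\<Sum>s\<in>S. w s * s ^ k) - moments A k" for k
  define Q where "Q = (\<Prod>s\<in>S. [:- s, 1:])"
  have degQ: "Polynomial.degree Q = d - 1"
    unfolding Q_def using S by (subst degree_prod_sum_eq) auto
  have leadQ: "Polynomial.coeff Q (d - 1) = 1"
    using degQ lead_coeff_prod[of "\<lambda>s. [:- s, 1:]" S] by (simp add: Q_def)
  have polyQ: "poly Q z = (\<Prod>s\<in>S. z - s)" for z
    by (simp add: Q_def poly_prod)
  have sumQ: "(\<Sum>t\<le>d - 1. Polynomial.coeff Q t * z ^ (l + t)) = z ^ l * poly Q z" for l z
    by (simp add: poly_altdef degQ sum_distrib_left power_add mult_ac)
  \<comment> \<open>The node sums vanish because \<open>Q\<close> is zero on \<open>S\<close>. For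
    the moments, \<open>A * poly Q \<i>\<close> and \<open>cnj A * poly Q (- \<i>)\<close> both
    equal \<open>poly Q 0\<close>: they balance the term at 0 when \<open>l = 0\<close> and cancel
    each other when \<open>l = 1\<close>.\<close>
  have rec: "(\<Sum>t\<le>d - 1. Polynomial.coeff Q t * err (l + t)) = 0" if "l \<le> 1" for l
  proof -
    have "(\<Sum>t\<le>d - 1. Polynomial.coeff Q t * (\<Sum>s\<in>S. w s * s ^ (l + t)))
        = (\<Sum>s\<in>S. w s * (\<Sum>t\<le>d - 1. Polynomial.coeff Q t * s ^ (l + t)))"
      unfolding sum_distrib_left by (subst sum.swap) (simp add: mult_ac)
    also have "\<dots> = 0"
      unfolding sumQ polyQ using S(1) by (intro sum.neutral) auto
    finally have 1: "(\<Sum>t\<le>d - 1. Polynomial.coeff Q t * (\<Sum>s\<in>S. w s * s ^ (l + t))) = 0" .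
    have "(\<Sum>t\<le>d - 1. Polynomial.coeff Q t * moments A (l + t))
        = A * (\<Sum>t\<le>d - 1. Polynomial.coeff Q t * \<i> ^ (l + t))
          + cnj A * (\<Sum>t\<le>d - 1. Polynomial.coeff Q t * (- \<i>) ^ (l + t))
          - 2 * (\<Sum>t\<le>d - 1. Polynomial.coeff Q t * 0 ^ (l + t))"
      unfolding moments_def
      by (simp only: sum_distrib_left sum.distrib sum_subtractf distrib_left right_diff_distrib mult_ac)
    also have "\<dots> = \<i> ^ l * (A * poly Q \<i>) + (- \<i>) ^ l * (cnj A * poly Q (- \<i>)) - 2 * 0 ^ l * poly Q 0"
      unfolding sumQ by (simp add: algebra_simps)
    also have "\<dots> = 0"
      using A that unfolding polyQ by (cases l) auto
    finally show ?thesis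
      using 1 unfolding err_def by (simp add: algebra_simps sum_subtractf)
  qed
  have low: "err k = 0" if "k < d - 1" for k
    using w(2)[OF that] by (simp add: err_def)
  \<comment> \<open>As \<open>Q\<close> is monic, the recurrence with all earlier errors zero leaves
    only the last error.\<close>
  have top: "err (l + (d - 1)) = 0" if "l \<le> 1" "\<And>k. k < l + (d - 1) \<Longrightarrow> err k = 0" for l
  proof -
    have "(\<Sum>t\<le>d - 1. Polynomial.coeff Q t * err (l + t)) =
        (\<Sum>t\<in>{d - 1}. Polynomial.coeff Q t * err (l + t))"
      using that by (intro sum.mono_neutral_right) auto
    with rec[OF that(1)] leadQ show ?thesis by simp
  qed
  have m1: "err (d - 1) = 0" using top[of 0] low by simp
  then have "err d = 0" using top[of 1] low d by (cases "d") (auto simp: less_Suc_eq)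
  with m1 have "err k = 0" if "k \<le> d" for k
    using low[of k] that d by (metis One_nat_def Suc_pred le_neq_implies_less less_Suc_eq less_eq_Suc_le)
  then have "has_K_representation K d (form_of d (moments A)) (card S)"
    using w(1) S by (intro has_K_representation_form_of_nodes[where w = w, OF K])
      (auto simp: err_def)
  then show ?thesis by (simp add: S(3))
qed

section \<open>Ranks of the form over three fields\<close>

lemma complex_subfield_Reals: "complex_subfield \<real>"
  unfolding complex_subfield_iff by (auto intro: Reals_inverse)

lemma complex_subfield_UNIV: "complex_subfield UNIV"
  unfolding complex_subfield_iff by simp

text \<open>The integers 0, ..., d are distinct and lie in every subfield, so they serve as nodes
  for all \<open>d + 1\<close> moments. This makes the \<open>LEAST\<close> in \<open>K_rank\<close>
  attained.\<close>

lemma representation_exists: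
  assumes K: "complex_subfield K" and a: "\<And>k. a k \<in> K"
  shows "\<exists>r. has_K_representation K d (form_of d a) r"
proof -
  define S where "S = (of_nat :: nat \<Rightarrow> complex) ` {..d}"
  have S: "finite S" "S \<subseteq> K" "card S = Suc d"
    by (auto simp: S_def card_image inj_on_def intro: subfield_closed[OF K])
  obtain w where "\<And>s. s \<in> S \<Longrightarrow> w s \<in> K" "\<And>k. k \<le> d \<Longrightarrow> (\<Sum>s\<in>S. w s * s ^ k) = a k"
    using vandermonde_solvable[OF K S(1,2), of a] a S(3) by (auto simp: less_Suc_eq_le)
  with S show ?thesis
    using has_K_representation_form_of_nodes[OF K S(1), of w d a] by blast
qed

lemma complex_representation: "has_K_representation UNIV d (form_of d (moments A)) 3"
proof -
  define S where "S = {\<i>, - \<i>, 0 :: complex}"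
  have [simp]: "\<i> \<noteq> - \<i>" by (simp add: complex_eq_iff)
  have "has_K_representation UNIV d (form_of d (moments A)) (card S)"
    by (rule has_K_representation_form_of_nodes[where
          w = "\<lambda>s. if s = \<i> then A else if s = - \<i> then cnj A else - 2"])
      (auto simp: complex_subfield_UNIV S_def moments_def complex_eq_iff[of _ "-\<i>"])
  moreover have "card S = 3"
    by (simp add: S_def)
  ultimately show ?thesis by simp
qed

text \<open>The rank is at most 3 over the complex numbers, exactly \<open>d - 1\<close> over
  \<open>K\<close> and at least \<open>d\<close> over the reals; \<open>d \<ge> 5\<close> gives 3 <
  d - 1.\<close>

lemma three_ranks_of_apolar_nodes:
  assumes d: "d \<ge> 5" and K: "complex_subfield K" "\<i> \<notin> K"
    and S: "finite S" "S \<subseteq> K" "card S = d - 1"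
    and mom: "\<And>k. moments A k \<in> K" "\<And>k. moments A k \<in> \<real>" and cA: "cmod A > 1"
    and A: "A * (\<Prod>s\<in>S. \<i> - s) = (\<Prod>s\<in>S. - s)" "cnj A * (\<Prod>s\<in>S. - \<i> - s) = (\<Prod>s\<in>S. - s)"
  shows "\<exists>p. binary_form d p \<and>
           (\<exists>K\<^sub>1 K\<^sub>2 K\<^sub>3.
              complex_subfield K\<^sub>1 \<and> complex_subfield K\<^sub>2 \<and> complex_subfield K\<^sub>3 \<and>
              coeffs_in K\<^sub>1 p \<and> coeffs_in K\<^sub>2 p \<and> coeffs_in K\<^sub>3 p \<and>
              K_rank K\<^sub>1 d p \<noteq> K_rank K\<^sub>2 d p \<and>
              K_rank K\<^sub>1 d p \<noteq> K_rank K\<^sub>3 d p \<and>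
              K_rank K\<^sub>2 d p \<noteq> K_rank K\<^sub>3 d p)"
proof -
  define p where "p = form_of d (moments A)"
  have A0: "A \<noteq> 0" using cA by auto
  \<comment> \<open>These two moments are -2 Im A and -2 Re A.\<close>
  have "moments A 1 \<noteq> 0 \<or> moments A 2 \<noteq> 0"
    using A0 by (auto simp: moments_def complex_eq_iff power2_eq_square)
  moreover have "1 \<le> d" "2 \<le> d" using d by auto
  ultimately obtain k where k: "k \<le> d" "moments A k \<noteq> 0" by blast
  have "p \<noteq> 0"
  proof
    assume "p = 0"
    then have "bcoeff p (d - k) k = 0" by (simp add: bcoeff_def)
    with k show False by (simp add: p_def bcoeff_form_of)
  qed
  then have form: "binary_form d p"
    by (auto simp: binary_form_def p_def bcoeff_form_of split: if_splits)
  have coeffs: "coeffs_in L p" if "complex_subfield L" "\<And>k. moments A k \<in> L" for L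
    using that by (auto simp: coeffs_in_def p_def bcoeff_form_of intro: subfield_closed)
  have rank_le: "K_rank L d p \<le> r" if "has_K_representation L d p r" for L r
    unfolding K_rank_def by (rule Least_le) (rule that)
  have rank_rep: "has_K_representation L d p (K_rank L d p)"
    if "complex_subfield L" "\<And>k. moments A k \<in> L" for L
    unfolding K_rank_def p_def by (rule LeastI_ex, rule representation_exists[OF that])
  have 1: "K_rank UNIV d p \<le> 3"
    by (rule rank_le) (simp add: p_def complex_representation)
  have 2: "d \<le> K_rank \<real> d p"
    using rank_rep[OF complex_subfield_Reals mom(2)] d cA
    by (intro real_representation_length[of d A]) (auto simp: p_def)
  have 3: "d \<le> K_rank K d p + 1"
    using rank_rep[OF K(1) mom(1)] d K A0
    by (intro representation_length_without_i[of K A d]) (auto simp: p_def)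
  have 4: "K_rank K d p \<le> d - 1"
    using has_K_representation_apolar_nodes[OF K(1) S _ mom(1) A] d
    by (intro rank_le) (simp add: p_def)
  show ?thesis
    using form coeffs[OF complex_subfield_UNIV] coeffs[OF complex_subfield_Reals mom(2)]
      coeffs[OF K(1) mom(1)] complex_subfield_UNIV complex_subfield_Reals K(1) 1 2 3 4 d
    by (intro exI[of _ p] conjI exI[of _ UNIV] exI[of _ \<real>] exI[of _ K]) auto
qed


section \<open>Rationality of the coefficients and irrationality of the square root of 2\<close>

lemma complex_of_rat: "complex_of_real (of_rat r) = of_rat r"
  by (cases r) (simp add: of_rat_rat)

lemma complex_Rats_subset_Reals: "(\<rat> :: complex set) \<subseteq> \<real>"
  by (auto elim!: Rats_cases simp flip: complex_of_rat)

text \<open>The part of the moments without the term at 0 changes sign when \<open>k\<close> grows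
  by 2, so only its first two values, 2 Re A and -2 Im A, matter.\<close>

lemma moments_rational:
  assumes "x \<in> \<rat>" "y \<in> \<rat>"
  shows "moments (Complex x y) k \<in> \<rat>"
proof -
  define A where "A = Complex x y"
  have "of_real x \<in> (\<rat> :: complex set)" "of_real y \<in> (\<rat> :: complex set)"
    using assms by (auto elim!: Rats_cases simp: complex_of_rat)
  moreover have "A + cnj A = 2 * of_real x" "A * \<i> - cnj A * \<i> = - 2 * of_real y"
    by (auto simp: A_def complex_eq_iff)
  ultimately have base: "A + cnj A \<in> \<rat>" "A * \<i> - cnj A * \<i> \<in> \<rat>" by auto
  have "A * \<i> ^ k + cnj A * (- \<i>) ^ k \<in> \<rat>"
  proof (induction k rule: induct_nat_012)
    case (ge2 k)
    have "A * \<i> ^ Suc (Suc k) + cnj A * (- \<i>) ^ Suc (Suc k) = - (A * \<i> ^ k + cnj A * (- \<i>) ^ k)"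
      by simp
    with ge2 show ?case by (metis Rats_minus_iff)
  qed (use base in simp_all)
  then show ?thesis
    unfolding moments_def A_def by (intro Rats_diff Rats_mult Rats_power) auto
qed

text \<open>Descent on a fraction in lowest terms. Comparing imaginary parts in i = a + b sqrt(-2)
  would produce such an \<open>r\<close>, so this keeps i out of Q(sqrt -2).\<close>

lemma two_times_rat_square_neq_1: "2 * (r * r) \<noteq> (1 :: rat)"
proof
  assume eq: "2 * (r * r) = 1"
  obtain m n where mn: "quotient_of r = (m, n)" by fastforce
  have n: "n > 0" and cop: "coprime m n" and r: "r = of_int m / of_int n"
    using quotient_of_denom_pos[OF mn] quotient_of_coprime[OF mn] quotient_of_div[OF mn] by auto
  have "of_int (2 * (m * m)) = (of_int (n * n) :: rat)"
    using eq n unfolding r by (simp add: field_simps)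
  then have *: "2 * (m * m) = n * n" by (simp only: of_int_eq_iff)
  then have "even n" by (metis dvd_triv_left even_mult_iff)
  then obtain l where "n = 2 * l" by blast
  with * have "m * m = 2 * (l * l)" by simp
  then have "even m" by (metis dvd_triv_left even_mult_iff)
  with \<open>even n\<close> cop show False using coprime_common_divisor[of m n 2] by simp
qed

section \<open>The field Q(sqrt -2)\<close>

definition sqrt_neg2 :: complex where
  "sqrt_neg2 = Complex 0 (sqrt 2)"

lemma sqrt_neg2_square: "sqrt_neg2 * sqrt_neg2 = - 2"
  by (simp add: sqrt_neg2_def complex_eq_iff)

definition Rats_sqrt_neg2 :: "complex set" where
  "Rats_sqrt_neg2 = {a + b * sqrt_neg2 |a b. a \<in> \<rat> \<and> b \<in> \<rat>}"

lemma Rats_sqrt_neg2I: "a \<in> \<rat> \<Longrightarrow> b \<in> \<rat> \<Longrightarrow> x = a + b * sqrt_neg2 \<Longrightarrow> x \<in> Rats_sqrt_neg2"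
  by (auto simp: Rats_sqrt_neg2_def)

lemma Rats_subset_Rats_sqrt_neg2: "\<rat> \<subseteq> Rats_sqrt_neg2"
  by (auto intro: Rats_sqrt_neg2I[where b = 0])

lemma complex_subfield_Rats_sqrt_neg2: "complex_subfield Rats_sqrt_neg2"
  unfolding complex_subfield_iff
proof (intro conjI ballI)
  show "1 \<in> Rats_sqrt_neg2"
    using Rats_subset_Rats_sqrt_neg2 by auto
  fix x assume "x \<in> Rats_sqrt_neg2"
  then obtain a b where x: "a \<in> \<rat>" "b \<in> \<rat>" "x = a + b * sqrt_neg2"
    by (auto simp: Rats_sqrt_neg2_def)
  show "inverse x \<in> Rats_sqrt_neg2"
  proof (cases "x = 0")
    case False
    \<comment> \<open>\<open>N\<close> is the norm of \<open>x\<close>, the product of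
      \<open>x\<close> with its conjugate; it is nonzero because the norm form is positive
      definite.\<close>
    define N where "N = a * a + 2 * (b * b)"
    have N: "N \<in> \<rat>" using x by (simp add: N_def)
    have "x * (a - b * sqrt_neg2) = a * a - b * b * (sqrt_neg2 * sqrt_neg2)"
      unfolding x by (simp add: algebra_simps)
    then have prod: "x * (a - b * sqrt_neg2) = N"
      by (simp add: N_def sqrt_neg2_square)
    have ab: "Im a = 0" "Im b = 0"
      using x complex_Rats_subset_Reals complex_is_Real_iff by auto
    have "N \<noteq> 0"
    proof
      assume "N = 0"
      then have "Re a * Re a + 2 * (Re b * Re b) = 0"
        using ab by (simp add: N_def complex_eq_iff)
      moreover have "Re a * Re a \<ge> 0" "Re b * Re b \<ge> 0" by simp_all
      ultimately have "Re a * Re a = 0" "Re b * Re b = 0" by linarith+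
      then have "Re a = 0" "Re b = 0" by simp_all
      then show False using ab False x by (simp add: complex_eq_iff)
    qed
    then have "inverse x = (a - b * sqrt_neg2) / N"
      using prod False by (simp add: field_simps)
    then show ?thesis
      using x N by (intro Rats_sqrt_neg2I[of "a / N" "- b / N"]) (auto simp: diff_divide_distrib)
  qed (use Rats_subset_Rats_sqrt_neg2 in auto)
  fix y assume "y \<in> Rats_sqrt_neg2"
  then obtain a' b' where y: "a' \<in> \<rat>" "b' \<in> \<rat>" "y = a' + b' * sqrt_neg2"
    by (auto simp: Rats_sqrt_neg2_def)
  show "x - y \<in> Rats_sqrt_neg2"
    using x y by (intro Rats_sqrt_neg2I[of "a - a'" "b - b'"]) (auto simp: algebra_simps)
  have "x * y = a * a' + (a * b' + b * a') * sqrt_neg2 + b * b' * (sqrt_neg2 * sqrt_neg2)"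
    unfolding x y by (simp add: algebra_simps)
  then show "x * y \<in> Rats_sqrt_neg2"
    using x y unfolding sqrt_neg2_square
    by (intro Rats_sqrt_neg2I[of "a * a' - 2 * (b * b')" "a * b' + b * a'"])
      (auto intro!: Rats_mult Rats_add Rats_diff)
qed

lemma i_notin_Rats_sqrt_neg2: "\<i> \<notin> Rats_sqrt_neg2"
proof
  assume "\<i> \<in> Rats_sqrt_neg2"
  then obtain a b where ab: "a \<in> \<rat>" "b \<in> \<rat>" "\<i> = a + b * sqrt_neg2"
    by (auto simp: Rats_sqrt_neg2_def)
  then have "Im a = 0" using complex_Rats_subset_Reals complex_is_Real_iff by auto
  obtain r where b: "b = of_real (of_rat r)"
    using ab(2) by (auto elim!: Rats_cases simp: complex_of_rat)
  have "1 = of_rat r * sqrt 2"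
    using arg_cong[OF ab(3), of Im] \<open>Im a = 0\<close> by (simp add: b sqrt_neg2_def)
  then have "1 = (of_rat r * sqrt 2) * (of_rat r * sqrt 2)" by simp
  also have "\<dots> = of_rat (2 * (r * r))" by (simp add: of_rat_mult)
  finally show False using two_times_rat_square_neq_1[of r]
    by (metis of_rat_eq_1_iff)
qed

section \<open>Apolar nodes in Q(sqrt -2)\<close>

text \<open>The nodes (m/2) sqrt(-2) and -(m/2) sqrt(-2) are the roots of z^2 + m^2/2, so the node
  polynomial q is even with rational coefficients, and \<open>R\<close> is q(0)/q(i) = q(0)/q(-i).
  Starting at m = 2 keeps every factor m^2/2 - 1 of q(i) positive; m = 1 would contribute only the
  ratio -1.\<close>

lemma apolar_nodes_Rats_sqrt_neg2:
  assumes n: "n \<ge> 1"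
  defines "P \<equiv> {2..Suc n}"
  defines "S \<equiv> (\<lambda>m. of_nat m / 2 * sqrt_neg2) ` P \<union> (\<lambda>m. - (of_nat m / 2) * sqrt_neg2) ` P"
  defines "R \<equiv> (\<Prod>m\<in>P. (real m ^ 2 / 2) / (real m ^ 2 / 2 - 1))"
  shows "finite S" "card S = 2 * n" "S \<subseteq> Rats_sqrt_neg2" "1 \<notin> S"
    "R \<in> \<rat>" "R \<ge> 2"
    "of_real R * (\<Prod>s\<in>S. \<i> - s) = (\<Prod>s\<in>S. - s)" "of_real R * (\<Prod>s\<in>S. - \<i> - s) = (\<Prod>s\<in>S. - s)"
proof -
  have w0: "sqrt_neg2 \<noteq> 0" by (simp add: sqrt_neg2_def complex_eq_iff)
  define f where "f m = of_nat m / 2 * sqrt_neg2" for m :: nat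
  define g where "g m = - (of_nat m / 2) * sqrt_neg2" for m :: nat
  have S: "S = f ` P \<union> g ` P" by (simp add: S_def f_def g_def)
  have fin: "finite P" by (simp add: P_def)
  have inj: "inj_on f P" "inj_on g P" using w0 by (auto simp: inj_on_def f_def g_def)
  have disj: "f ` P \<inter> g ` P = {}"
  proof -
    have "f m \<noteq> g k" if "m \<in> P" for m k
    proof
      assume "f m = g k"
      moreover have "of_nat (m + k) * sqrt_neg2 = 2 * (f m - g k)"
        by (simp add: f_def g_def algebra_simps)
      ultimately have "(of_nat (m + k) :: complex) = 0"
        using w0 by simp
      with that show False by (simp add: P_def del: of_nat_add)
    qed
    then show ?thesis by blast
  qed
  show "finite S" using fin by (simp add: S)
  show "card S = 2 * n"
    using fin inj disj by (simp add: S card_Un_disjoint card_image) (simp add: P_def)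
  show "S \<subseteq> Rats_sqrt_neg2"
  proof -
    have "f m \<in> Rats_sqrt_neg2" "g m \<in> Rats_sqrt_neg2" for m
      by (rule Rats_sqrt_neg2I[of 0 "of_nat m / 2"] Rats_sqrt_neg2I[of 0 "- (of_nat m / 2)"];
          simp add: f_def g_def)+
    then show ?thesis by (auto simp: S)
  qed
  show "1 \<notin> S" by (auto simp: S_def sqrt_neg2_def complex_eq_iff)
  show "R \<in> \<rat>" unfolding R_def
    by (induction P rule: infinite_finite_induct) auto
  have sq: "real m ^ 2 \<ge> 4" if "m \<in> P" for m
    using that power_mono[of 2 "real m" 2] by (simp add: P_def)
  \<comment> \<open>The factor for m = 2 is 2/(2 - 1) = 2, and every other factor is at least
    1.\<close>
  have "R = 2 * (\<Prod>m\<in>P - {2}. (real m ^ 2 / 2) / (real m ^ 2 / 2 - 1))"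
    unfolding R_def using fin n by (subst prod.remove[of _ 2]) (auto simp: P_def)
  moreover have "(\<Prod>m\<in>P - {2}. (real m ^ 2 / 2) / (real m ^ 2 / 2 - 1)) \<ge> 1"
    using sq by (intro prod_ge_1) (auto simp: field_simps dest!: sq)
  ultimately show "R \<ge> 2" by simp
  have prodS: "(\<Prod>s\<in>S. z - s) = (\<Prod>m\<in>P. z ^ 2 + of_nat m ^ 2 / 2)" for z
  proof -
    have "(\<Prod>s\<in>S. z - s) = (\<Prod>m\<in>P. (z - f m) * (z - g m))"
      unfolding S using fin inj disj
      by (simp add: prod.union_disjoint prod.reindex prod.distrib)
    also have "\<dots> = (\<Prod>m\<in>P. z ^ 2 + of_nat m ^ 2 / 2)"
    proof (rule prod.cong)
      fix m
      have "(z - f m) * (z - g m) = z ^ 2 - of_nat m ^ 2 / 4 * (sqrt_neg2 * sqrt_neg2)"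
        by (simp add: f_def g_def power2_eq_square algebra_simps)
      then show "(z - f m) * (z - g m) = z ^ 2 + of_nat m ^ 2 / 2"
        by (simp add: sqrt_neg2_square)
    qed simp
    finally show ?thesis .
  qed
  have R: "of_real R * (\<Prod>m\<in>P. - 1 + of_nat m ^ 2 / 2) = (\<Prod>m\<in>P. of_nat m ^ 2 / 2 :: complex)"
  proof -
    have "R * (\<Prod>m\<in>P. - 1 + real m ^ 2 / 2) = (\<Prod>m\<in>P. real m ^ 2 / 2)"
      unfolding R_def prod.distrib[symmetric]
      by (intro prod.cong) (auto simp: field_simps dest!: sq)
    then have "complex_of_real (R * (\<Prod>m\<in>P. - 1 + real m ^ 2 / 2)) = of_real (\<Prod>m\<in>P. real m ^ 2 / 2)"
      by simp
    then show ?thesis by simp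
  qed
  show "of_real R * (\<Prod>s\<in>S. \<i> - s) = (\<Prod>s\<in>S. - s)" "of_real R * (\<Prod>s\<in>S. - \<i> - s) = (\<Prod>s\<in>S. - s)"
    using R prodS[of 0] prodS[of \<i>] prodS[of "- \<i>"] by simp_all
qed

theorem theorem3p1:
  fixes d :: nat
  assumes "d \<ge> 5"
  shows "\<exists>p. binary_form d p \<and>
           (\<exists>K\<^sub>1 K\<^sub>2 K\<^sub>3.
              complex_subfield K\<^sub>1 \<and> complex_subfield K\<^sub>2 \<and> complex_subfield K\<^sub>3 \<and>
              coeffs_in K\<^sub>1 p \<and> coeffs_in K\<^sub>2 p \<and> coeffs_in K\<^sub>3 p \<and>
              K_rank K\<^sub>1 d p \<noteq> K_rank K\<^sub>2 d p \<and>
              K_rank K\<^sub>1 d p \<noteq> K_rank K\<^sub>3 d p \<and>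
              K_rank K\<^sub>2 d p \<noteq> K_rank K\<^sub>3 d p)"
proof -
  \<comment> \<open>The \<open>2 * n\<close> paired nodes are \<open>d - 1\<close> in number for odd
    \<open>d\<close>, where \<open>A = R\<close> works. For even \<open>d\<close> they are
    \<open>d - 2\<close>, and the node 1 is added.\<close>
  define n where "n = (d - 1) div 2"
  have n: "n \<ge> 1" using assms by (simp add: n_def)
  obtain S R where S: "finite S" "card S = 2 * n" "S \<subseteq> Rats_sqrt_neg2" "1 \<notin> S"
    and R: "R \<in> \<rat>" "R \<ge> 2"
    and SR: "of_real R * (\<Prod>s\<in>S. \<i> - s) = (\<Prod>s\<in>S. - s)"
      "of_real R * (\<Prod>s\<in>S. - \<i> - s) = (\<Prod>s\<in>S. - s)"
    using apolar_nodes_Rats_sqrt_neg2[OF n] by blast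
  have moments: "moments A k \<in> Rats_sqrt_neg2" "moments A k \<in> \<real>" if "Re A \<in> \<rat>" "Im A \<in> \<rat>" for A k
    using moments_rational[OF that, of k] complex_Rats_subset_Reals Rats_subset_Rats_sqrt_neg2 by auto
  note three = three_ranks_of_apolar_nodes[OF assms complex_subfield_Rats_sqrt_neg2
      i_notin_Rats_sqrt_neg2 _ _ _ moments]
  show ?thesis
  proof (cases "odd d")
    case True
    then have "card S = d - 1" using S(2) by (simp add: n_def)
    then show ?thesis
      using S R SR by (intro three[of S "of_real R"]) auto
  next
    case False
    \<comment> \<open>The node 1 multiplies q(i) by i - 1 and q(0) by -1, so \<open>A\<close> has to
      be -R/(i - 1) = R(1 + i)/2. Its modulus is R/sqrt 2, which exceeds 1 since
      \<open>R \<ge> 2\<close>.\<close>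
    define A where "A = Complex (R / 2) (R / 2)"
    have card: "card (insert 1 S) = d - 1"
      using S False assms unfolding n_def by simp
    have "R ^ 2 \<ge> 2 ^ 2" using R by (intro power_mono) auto
    then have A: "cmod A > 1" by (simp add: A_def cmod_def power_divide)
    have "A * (\<i> - 1) = - of_real R" "cnj A * (- \<i> - 1) = - of_real R"
      by (simp_all add: A_def complex_eq_iff)
    then have "A * (\<Prod>s\<in>insert 1 S. \<i> - s) = (\<Prod>s\<in>insert 1 S. - s)"
      "cnj A * (\<Prod>s\<in>insert 1 S. - \<i> - s) = (\<Prod>s\<in>insert 1 S. - s)"
      using S(1,4) SR by (simp_all flip: mult.assoc)
    moreover have "1 \<in> Rats_sqrt_neg2"
      using Rats_subset_Rats_sqrt_neg2 by auto
    ultimately show ?thesis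
      using S R A card by (intro three[of "insert 1 S" A]) (auto simp: A_def)
  qed
qed

end
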